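(* Let $G=(V,E)$ be a strongly regular graph with parameters $(n,d,\alpha,\beta)$. If the girth of $G$ is $4$, then the condensed Ricci curvature satisfies $$\Bbbk(x,y)=\frac{2}{d}$$ for all $xy\in E$. In particular, all strongly regular graphs of girth $4$ have positive condensed Ricci curvature (along edges).
   Context: A strongly regular graph with parameters $(n,d,\alpha,\beta)$ is a finite undirected simple graph with $n$ vertices, all of degree $d$, such that any two adjacent vertices have exactly $\alpha\ge 0$ common neighbors and any two distinct nonadjacent vertices have exactly $\beta\ge 1$ common neighbors. The girth of a graph is the length of its shortest cycle. Let $\rho$ be the shortest-path distance on $G$ and $\Gamma(x)=\{z\in V: xz\in E\}$. A probability measure on $G$ is a function $\mu:V\to[0,1]$ with $\sum_{v\in V}\mu(v)=1$. A transport plan between probability measures $\mu$ and $\nu$ is a function $\xi:V\times V\to[0,1]$ with $\sum_{w\in V}\xi(v,w)=\mu(v)$ for all $v\in V$ and $\sum_{v\in V}\xi(v,w)=\nu(w)$ for all $w\in V$. The transport ($L^1$-Wasserstein) distance is $W(\mu,\nu)=\inf_{\xi}\sum_{x\in V}\sum_{y\in V}\rho(x,y)\,\xi(x,y)$, the infimum being over all transport plans $\xi$ between $\mu$ and $\nu$. For $0\le\varepsilon\le 1$ and $x\in V$, let $m_x^{\varepsilon}$ be the probability measure with $m_x^{\varepsilon}(x)=1-\varepsilon$, $m_x^{\varepsilon}(y)=\frac{\varepsilon}{|\Gamma(x)|}$ for $y\in\Gamma(x)$, and $m_x^{\varepsilon}(y)=0$ otherwise. For distinct $x,y\in V$ set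 $\kappa_{\varepsilon}(x,y)=1-\frac{W(m_x^{\varepsilon},m_y^{\varepsilon})}{\rho(x,y)}$. The condensed Ricci curvature is $\Bbbk(x,y)=\lim_{\varepsilon\to 0^+}\frac{\kappa_{\varepsilon}(x,y)}{\varepsilon}$ (this limit is known to exist). *)

theory Defs
  imports "HOL-Analysis.Analysis" "Graph_Theory.Graph_Theory"
begin

definition nbhd :: "'a pair_pre_digraph \<Rightarrow> 'a \<Rightarrow> 'a set" where
  "nbhd G x = {z \<in> pverts G. (x, z) \<in> parcs G}"

text \<open>
  An undirected edge \<open>xy\<close> is represented by the two arcs \<open>(x, y)\<close> and \<open>(y, x)\<close>:
  \<^locale>\<open>pair_graph\<close> is the locale of finite, symmetric, loop-free graphs without multiple edges.
\<close>

locale strongly_regular_graph = pair_graph G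
  for G :: "'a pair_pre_digraph" +
  fixes n d \<alpha> \<beta> :: nat
  assumes card_verts: "card (pverts G) = n"
    and regular: "x \<in> pverts G \<Longrightarrow> card (nbhd G x) = d"
    and adjacent: "(x, y) \<in> parcs G \<Longrightarrow> card (nbhd G x \<inter> nbhd G y) = \<alpha>"
    and nonadjacent: "\<lbrakk>x \<in> pverts G; y \<in> pverts G; x \<noteq> y; (x, y) \<notin> parcs G\<rbrakk>
          \<Longrightarrow> card (nbhd G x \<inter> nbhd G y) = \<beta>"
    and beta_pos: "\<beta> \<ge> 1"

text \<open>
  \<^const>\<open>pre_digraph.cycle\<close> is the notion of a directed cycle, so each edge yields a cycle
  \<open>x, y, x\<close> of length 2.  The bound on the length removes exactly these; the
  girth of an acyclic graph is \<open>\<infinity>\<close>.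
\<close>

definition girth :: "'a pair_pre_digraph \<Rightarrow> enat" where
  "girth G = (INF p \<in> {p. pre_digraph.cycle (with_proj G) p \<and> 3 \<le> length p}. enat (length p))"

text \<open>
  The extended-real shortest-path distance of the library, with unit weights. It is finite in
  connected graphs; strongly regular graphs are connected because \<open>\<beta> \<ge> 1\<close>.
\<close>

definition graph_dist :: "'a pair_pre_digraph \<Rightarrow> 'a \<Rightarrow> 'a \<Rightarrow> real" where
  "graph_dist G x y = real_of_ereal (wf_digraph.\<mu> (with_proj G) (\<lambda>_. 1) x y)"

text \<open>
  Functions on \<open>V\<close> and \<open>V \<times> V\<close> are represented by functions on the whole type, whose values
  outside \<open>V\<close> are irrelevant.
\<close>

definition transport_plan ::
    "'a pair_pre_digraph \<Rightarrow> ('a \<Rightarrow> real) \<Rightarrow> ('a \<Rightarrow> real) \<Rightarrow> ('a \<Rightarrow> 'a \<Rightarrow> real) \<Rightarrow> bool" where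
  "transport_plan G \<mu> \<nu> \<xi> \<longleftrightarrow>
     (\<forall>v\<in>pverts G. \<forall>w\<in>pverts G. \<xi> v w \<in> {0..1}) \<and>
     (\<forall>v\<in>pverts G. (\<Sum>w\<in>pverts G. \<xi> v w) = \<mu> v) \<and>
     (\<forall>w\<in>pverts G. (\<Sum>v\<in>pverts G. \<xi> v w) = \<nu> w)"

definition transport_dist :: "'a pair_pre_digraph \<Rightarrow> ('a \<Rightarrow> real) \<Rightarrow> ('a \<Rightarrow> real) \<Rightarrow> real" where
  "transport_dist G \<mu> \<nu> =
     (INF \<xi> \<in> {\<xi>. transport_plan G \<mu> \<nu> \<xi>}.
        \<Sum>x\<in>pverts G. \<Sum>y\<in>pverts G. graph_dist G x y * \<xi> x y)"

definition lazy_walk :: "'a pair_pre_digraph \<Rightarrow> real \<Rightarrow> 'a \<Rightarrow> 'a \<Rightarrow> real" where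
  "lazy_walk G \<epsilon> x y =
     (if y = x then 1 - \<epsilon> else if y \<in> nbhd G x then \<epsilon> / real (card (nbhd G x)) else 0)"

definition eps_curvature :: "'a pair_pre_digraph \<Rightarrow> real \<Rightarrow> 'a \<Rightarrow> 'a \<Rightarrow> real" where
  "eps_curvature G \<epsilon> x y =
     1 - transport_dist G (lazy_walk G \<epsilon> x) (lazy_walk G \<epsilon> y) / graph_dist G x y"

text \<open>
  Only \<open>\<epsilon> \<in> (0, 1]\<close> matters for the limit.  \<^const>\<open>Lim\<close> is unspecified for a divergent
  function, so an equation for this constant can only be shown by establishing convergence.
\<close>

definition condensed_ricci :: "'a pair_pre_digraph \<Rightarrow> 'a \<Rightarrow> 'a \<Rightarrow> real" where
  "condensed_ricci G x y = Lim (at_right 0) (\<lambda>\<epsilon>. eps_curvature G \<epsilon> x y / \<epsilon>)"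

end

theory Submission
  imports Defs
begin

text \<open>
  In girth 4 the graph is triangle free and \<open>\<beta> \<ge> 2\<close>.  For an edge \<open>xy\<close> put
  \<open>A = \<Gamma>(x) - {y}\<close> and \<open>B = \<Gamma>(y) - {x}\<close>: the edges between \<open>A\<close> and \<open>B\<close> form a bipartite graph
  that is regular of degree \<open>\<beta> - 1 \<ge> 1\<close>.  Hence the mass on \<open>A\<close> can be spread evenly along these
  edges onto \<open>B\<close>, while mass \<open>1 - \<epsilon> - \<epsilon>/d\<close> moves from \<open>x\<close> to \<open>y\<close>, at a total cost of \<open>1 - 2\<epsilon>/d\<close>;
  no perfect matching (Hall's theorem) is needed.  The cost is optimal, because this is exactly
  the excess of \<open>m\<^sub>x\<close> over \<open>m\<^sub>y\<close> on the set \<open>A \<union> {x}\<close>, and all of the excess must leave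
  that set.
\<close>

section \<open>Limits and adjacency\<close>

lemma Lim_at_right_eventually_const:
  fixes f :: "real \<Rightarrow> real"
  assumes "eventually (\<lambda>x. f x = c) (at_right a)"
  shows "Lim (at_right a) f = c"
  by (rule tendsto_Lim) (use assms in \<open>auto intro: tendsto_eventually\<close>)

lemma (in pair_fin_digraph) finite_nbhd: "finite (nbhd G x)"
  unfolding nbhd_def using pair_finite_verts by simp

lemma (in pair_wf_digraph) mem_nbhd_iff: "z \<in> nbhd G x \<longleftrightarrow> (x, z) \<in> parcs G"
  unfolding nbhd_def using in_arcsD2 by auto

lemma (in pair_sym_digraph) arc_commute: "(u, v) \<in> parcs G \<longleftrightarrow> (v, u) \<in> parcs G"
  using arcs_symmetric by blast

section \<open>Distance via walk lengths\<close>

context pair_wf_digraph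
begin

lemma awalk_cost_unit: "awalk_cost (\<lambda>_. 1) p = real (length p)"
  by (induction p) simp_all

text \<open>The walk \<open>p\<close> and the bound \<open>k\<close> confine the extended-real
  infimum to finite values. This matters because \<open>real_of_ereal\<close> maps infinity to the
  default 0, so a lower bound on all walks alone would say nothing about
  \<open>graph_dist\<close>.\<close>

lemma graph_dist_bounds:
  assumes "awalk u p v" and "\<And>q. awalk u q v \<Longrightarrow> k \<le> length q"
  shows "real k \<le> graph_dist G u v" and "graph_dist G u v \<le> real (length p)"
proof -
  have le: "\<mu> (\<lambda>_. 1) u v \<le> ereal (length p)"
    using min_cost_le_walk_cost[OF assms(1), of "\<lambda>_. 1"] by (simp add: awalk_cost_unit)
  have ge: "ereal k \<le> \<mu> (\<lambda>_. 1) u v"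
    unfolding \<mu>_def by (rule INF_greatest) (use assms(2) in \<open>simp add: awalk_cost_unit\<close>)
  obtain r where r: "\<mu> (\<lambda>_. 1) u v = ereal r"
    using le ge by (cases "\<mu> (\<lambda>_. 1) u v") auto
  show "real k \<le> graph_dist G u v" "graph_dist G u v \<le> real (length p)"
    using le ge by (simp_all add: graph_dist_def r)
qed

lemma graph_dist_self:
  assumes "u \<in> pverts G"
  shows "graph_dist G u u = 0"
  using graph_dist_bounds[of u "[]" u 0] assms by (simp add: awalk_Nil_iff)

lemma graph_dist_ge_1:
  assumes "awalk u p v" "u \<noteq> v"
  shows "1 \<le> graph_dist G u v"
proof -
  have "1 \<le> length q" if "awalk u q v" for q
    using that assms(2) by (cases q) (auto simp: awalk_Nil_iff)
  then show ?thesis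
    using graph_dist_bounds(1)[OF assms(1), of 1] by simp
qed

end

lemma (in pair_loopfree_digraph) graph_dist_arc:
  assumes "(u, v) \<in> parcs G"
  shows "graph_dist G u v = 1"
proof -
  have walk: "awalk u [(u, v)] v"
    using assms by (simp add: awalk_simps in_arcsD1 in_arcsD2)
  then show ?thesis
    using graph_dist_ge_1[OF walk] graph_dist_bounds(2)[OF walk, of 0] assms no_loops'
    by fastforce
qed

section \<open>Transport plans and a lower bound for their cost\<close>

lemma transport_planI:
  assumes "finite (pverts G)"
    and nonneg: "\<And>v w. \<lbrakk>v \<in> pverts G; w \<in> pverts G\<rbrakk> \<Longrightarrow> 0 \<le> \<xi> v w"
    and rows: "\<And>v. v \<in> pverts G \<Longrightarrow> (\<Sum>w\<in>pverts G. \<xi> v w) = \<mu> v"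
    and columns: "\<And>w. w \<in> pverts G \<Longrightarrow> (\<Sum>v\<in>pverts G. \<xi> v w) = \<nu> w"
    and le_1: "\<And>v. v \<in> pverts G \<Longrightarrow> \<mu> v \<le> 1"
  shows "transport_plan G \<mu> \<nu> \<xi>"
proof -
  have "\<xi> v w \<le> 1" if "v \<in> pverts G" "w \<in> pverts G" for v w
  proof -
    have "\<xi> v w \<le> (\<Sum>w\<in>pverts G. \<xi> v w)"
      by (rule member_le_sum) (use that assms(1) nonneg in auto)
    then show ?thesis using rows le_1 that by fastforce
  qed
  then show ?thesis
    unfolding transport_plan_def using nonneg rows columns by auto
qed

text \<open>The easy half of Kantorovich duality, with the indicator of \<open>S\<close> as
  potential: the surplus of \<mu> over \<nu> on \<open>S\<close> has to leave \<open>S\<close>, and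
  each unit of mass that leaves pays at least 1.\<close>

lemma transport_cost_ge_excess:
  assumes fin: "finite (pverts G)" and S: "S \<subseteq> pverts G"
    and nonneg: "\<And>v w. \<lbrakk>v \<in> pverts G; w \<in> pverts G\<rbrakk> \<Longrightarrow> 0 \<le> graph_dist G v w"
    and ge_1: "\<And>v w. \<lbrakk>v \<in> S; w \<in> pverts G - S\<rbrakk> \<Longrightarrow> 1 \<le> graph_dist G v w"
    and plan: "transport_plan G \<mu> \<nu> \<xi>"
  shows "sum \<mu> S - sum \<nu> S \<le> (\<Sum>v\<in>pverts G. \<Sum>w\<in>pverts G. graph_dist G v w * \<xi> v w)"
proof -
  let ?V = "pverts G"
  have \<xi>: "0 \<le> \<xi> v w" if "v \<in> ?V" "w \<in> ?V" for v w
    using plan that by (auto simp: transport_plan_def)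
  have "sum \<mu> S = (\<Sum>v\<in>S. \<Sum>w\<in>?V. \<xi> v w)"
    using plan S by (intro sum.cong) (auto simp: transport_plan_def)
  also have "\<dots> = (\<Sum>v\<in>S. \<Sum>w\<in>S. \<xi> v w) + (\<Sum>v\<in>S. \<Sum>w\<in>?V - S. \<xi> v w)"
    by (simp add: sum.subset_diff[OF S fin] sum.distrib add.commute)
  finally have \<mu>: "sum \<mu> S = (\<Sum>v\<in>S. \<Sum>w\<in>S. \<xi> v w) + (\<Sum>v\<in>S. \<Sum>w\<in>?V - S. \<xi> v w)" .
  have "sum \<nu> S = (\<Sum>w\<in>S. \<Sum>v\<in>?V. \<xi> v w)"
    using plan S by (intro sum.cong) (auto simp: transport_plan_def)
  \<comment> \<open>Mass entering \<open>S\<close> from outside is dropped; it could only enlarge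
    the required outflow.\<close>
  also have "\<dots> \<ge> (\<Sum>w\<in>S. \<Sum>v\<in>S. \<xi> v w)"
    using S \<xi> fin by (intro sum_mono sum_mono2) auto
  finally have \<nu>: "(\<Sum>v\<in>S. \<Sum>w\<in>S. \<xi> v w) \<le> sum \<nu> S"
    by (subst sum.swap)
  have "(\<Sum>v\<in>S. \<Sum>w\<in>?V - S. \<xi> v w) \<le> (\<Sum>v\<in>S. \<Sum>w\<in>?V - S. graph_dist G v w * \<xi> v w)"
  proof (intro sum_mono)
    fix v w assume vw: "v \<in> S" "w \<in> ?V - S"
    have "1 * \<xi> v w \<le> graph_dist G v w * \<xi> v w"
      using ge_1[OF vw] \<xi>[of v w] S vw by (intro mult_right_mono) auto
    then show "\<xi> v w \<le> graph_dist G v w * \<xi> v w" by simp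
  qed
  also have "\<dots> \<le> (\<Sum>v\<in>S. \<Sum>w\<in>?V. graph_dist G v w * \<xi> v w)"
    using S nonneg \<xi> fin by (intro sum_mono sum_mono2) auto
  also have "\<dots> \<le> (\<Sum>v\<in>?V. \<Sum>w\<in>?V. graph_dist G v w * \<xi> v w)"
    using S nonneg \<xi> fin by (intro sum_mono2 sum_nonneg mult_nonneg_nonneg) auto
  finally show ?thesis using \<mu> \<nu> by linarith
qed

lemma transport_dist_eqI:
  assumes "transport_plan G \<mu> \<nu> \<xi>"
    and "(\<Sum>v\<in>pverts G. \<Sum>w\<in>pverts G. graph_dist G v w * \<xi> v w) = c"
    and "\<And>\<xi>. transport_plan G \<mu> \<nu> \<xi> \<Longrightarrow> c \<le> (\<Sum>v\<in>pverts G. \<Sum>w\<in>pverts G. graph_dist G v w * \<xi> v w)"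
  shows "transport_dist G \<mu> \<nu> = c"
  unfolding transport_dist_def by (rule cInf_eq_minimum) (use assms in auto)

section \<open>Girth and short cycles\<close>

lemma (in pair_graph) girth_le_3_if_triangle:
  assumes "(u, v) \<in> parcs G" "(v, w) \<in> parcs G" "(w, u) \<in> parcs G"
  shows "girth G \<le> 3"
proof -
  have "awalk u [(u, v), (v, w), (w, u)] u"
    using assms by (simp add: awalk_simps in_arcsD1 in_arcsD2)
  moreover have "distinct [v, w, u]"
    using assms no_loops' by auto
  ultimately have "cycle [(u, v), (v, w), (w, u)]"
    unfolding cycle_def by (intro exI[of _ u]) simp
  then have "girth G \<le> enat (length [(u, v), (v, w), (w, u)])"
    unfolding girth_def by (intro INF_lower) simp
  then show ?thesis by (simp add: numeral_eq_enat eval_nat_numeral)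
qed

text \<open>In the well-order \<open>enat\<close> the infimum of a nonempty set belongs to it. The
  set of cycle lengths is nonempty because the empty infimum is infinity, which differs from
  \<open>enat k\<close>.\<close>

lemma (in pair_graph) girth_attained:
  assumes "girth G = enat k"
  obtains p where "cycle p" "length p = k"
proof -
  let ?L = "(\<lambda>p. enat (length p)) ` {p. cycle p \<and> 3 \<le> length p}"
  have girth: "Inf ?L = enat k"
    using assms by (simp add: girth_def)
  then have "?L \<noteq> {}"
    by (metis Inf_empty top_enat_def enat.distinct(1))
  then obtain l where "l \<in> ?L"
    by (meson ex_in_conv)
  then have "Inf ?L \<in> ?L"
    by (rule wellorder_InfI)
  then have "enat k \<in> ?L"
    unfolding girth .
  then show thesis
    using that by auto
qed

section \<open>Local structure of strongly regular graphs\<close>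

context strongly_regular_graph
begin

text \<open>For nonadjacent vertices a common neighbour, given by \<beta> \<ge> 1, supplies a walk
  of length 2, which rules out the default value 0 of an infinite distance.\<close>

lemma graph_dist_distinct_ge_1:
  assumes "u \<in> pverts G" "v \<in> pverts G" "u \<noteq> v"
  shows "1 \<le> graph_dist G u v"
proof (cases "(u, v) \<in> parcs G")
  case True
  then show ?thesis by (simp add: graph_dist_arc)
next
  case False
  then have "nbhd G u \<inter> nbhd G v \<noteq> {}"
    using nonadjacent[OF assms] beta_pos by force
  then obtain z where "(u, z) \<in> parcs G" "(z, v) \<in> parcs G"
    using mem_nbhd_iff arc_commute by blast
  then have "awalk u [(u, z), (z, v)] v"
    by (simp add: awalk_simps in_arcsD1 in_arcsD2)
  then show ?thesis using graph_dist_ge_1 assms by blast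
qed

lemma graph_dist_nonneg:
  assumes "u \<in> pverts G" "v \<in> pverts G"
  shows "0 \<le> graph_dist G u v"
  using graph_dist_distinct_ge_1[OF assms] graph_dist_self assms by fastforce

text \<open>In a 4-cycle \<open>a b c e\<close> the diagonal \<open>ac\<close> would close a
  triangle. So \<open>a\<close> and \<open>c\<close> are nonadjacent, and \<open>b\<close> and
  \<open>e\<close> are two common neighbours.\<close>

lemma beta_ge_2_if_girth_4:
  assumes "girth G = 4"
  shows "2 \<le> \<beta>"
proof -
  have "girth G = enat 4" using assms by (simp add: numeral_eq_enat)
  then obtain p where p: "cycle p" "length p = 4" by (rule girth_attained)
  then obtain e1 e2 e3 e4 where "p = [e1, e2, e3, e4]"
    by (auto simp: length_Suc_conv eval_nat_numeral)
  \<comment> \<open>\<open>cycle\<close> asks for distinctness of the tail of the vertex list, where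
    the start \<open>a\<close> reappears as the last entry.\<close>
  with p(1) obtain a b c e where
    walk: "(a, b) \<in> parcs G" "(b, c) \<in> parcs G" "(c, e) \<in> parcs G" "(e, a) \<in> parcs G"
    and dist: "distinct [b, c, e, a]"
    unfolding cycle_def by (cases e1; cases e2; cases e3; cases e4) (auto simp: awalk_simps)
  have "(a, c) \<notin> parcs G"
    using girth_le_3_if_triangle[of a b c] walk assms arc_commute by auto
  then have "card (nbhd G a \<inter> nbhd G c) = \<beta>"
    using walk dist by (intro nonadjacent) (auto intro: in_arcsD1)
  moreover have "{b, e} \<subseteq> nbhd G a \<inter> nbhd G c"
    using walk arc_commute by (auto simp: mem_nbhd_iff)
  then have "card {b, e} \<le> card (nbhd G a \<inter> nbhd G c)"
    by (intro card_mono) (simp_all add: finite_nbhd)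
  ultimately show ?thesis using dist by auto
qed

text \<open>An edge \<open>vy\<close> would form a triangle with \<open>x\<close>, so
  \<open>v\<close> and \<open>y\<close> have \<beta> common neighbours. One of them is
  \<open>x\<close>; the others are the vertices counted here.\<close>

lemma card_nbhd_cross:
  assumes xy: "(x, y) \<in> parcs G"
    and no_triangle: "\<And>z. (x, z) \<in> parcs G \<Longrightarrow> (y, z) \<notin> parcs G"
    and v: "v \<in> nbhd G x - {y}"
  shows "card {w \<in> nbhd G y - {x}. (v, w) \<in> parcs G} = \<beta> - 1"
proof -
  have "(v, y) \<notin> parcs G" "v \<in> pverts G" "v \<noteq> y"
    using v no_triangle arc_commute in_arcsD2 by (auto simp: mem_nbhd_iff)
  then have "card (nbhd G v \<inter> nbhd G y) = \<beta>"
    using xy in_arcsD2 by (intro nonadjacent) auto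
  moreover have "{w \<in> nbhd G y - {x}. (v, w) \<in> parcs G} = (nbhd G v \<inter> nbhd G y) - {x}"
    by (auto simp: mem_nbhd_iff)
  moreover have "x \<in> nbhd G v \<inter> nbhd G y"
    using xy v arc_commute by (auto simp: mem_nbhd_iff)
  ultimately show ?thesis by (simp add: finite_nbhd)
qed

lemma degree_pos:
  assumes "(x, y) \<in> parcs G"
  shows "0 < d"
proof -
  have "card (nbhd G x) = d" "nbhd G x \<noteq> {}"
    using assms regular in_arcsD1 by (auto simp: mem_nbhd_iff)
  then show ?thesis using finite_nbhd card_gt_0_iff by metis
qed

section \<open>Transport distance across an edge\<close>

lemma transport_dist_lazy_walk:
  assumes xy: "(x, y) \<in> parcs G"
    and no_triangle: "\<And>z. (x, z) \<in> parcs G \<Longrightarrow> (y, z) \<notin> parcs G"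
    and \<beta>: "2 \<le> \<beta>"
    and \<epsilon>: "0 \<le> \<epsilon>" "\<epsilon> \<le> 1 / 2"
  shows "transport_dist G (lazy_walk G \<epsilon> x) (lazy_walk G \<epsilon> y) = 1 - 2 * \<epsilon> / real d"
proof -
  define A B where "A = nbhd G x - {y}" and "B = nbhd G y - {x}"
  \<comment> \<open>\<open>c\<close> is the mass of a single neighbour, and \<open>t\<close> is the
    degree of the bipartite graph between \<open>A\<close> and \<open>B\<close>.\<close>
  define c where "c = \<epsilon> / real d"
  define t where "t = real (\<beta> - 1)"
  \<comment> \<open>Mass \<open>c\<close> stays at each of \<open>x\<close> and \<open>y\<close>,
    the rest of \<open>x\<close> goes to \<open>y\<close>, and every vertex of \<open>A\<close>
    splits its mass \<open>c\<close> evenly over its \<open>t\<close> edges into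
    \<open>B\<close>.\<close>
  define \<xi> where "\<xi> v w =
    (1 - \<epsilon> - c) * (of_bool (v = x) * of_bool (w = y)) + c * (of_bool (v = x) * of_bool (w = x))
      + c * (of_bool (v = y) * of_bool (w = y))
      + c / t * of_bool (v \<in> A \<and> w \<in> B \<and> (v, w) \<in> parcs G)" for v w
  let ?V = "pverts G"
  have V: "x \<in> ?V" "y \<in> ?V" "finite ?V" "A \<subseteq> ?V" "B \<subseteq> ?V"
    using xy in_arcsD1 in_arcsD2 pair_finite_verts by (auto simp: A_def B_def nbhd_def)
  have yx: "(y, x) \<in> parcs G" and "x \<noteq> y"
    using xy arc_commute no_loops' by auto
  have AB: "x \<notin> A" "y \<notin> A" "x \<notin> B" "y \<notin> B" "A \<inter> B = {}"
    using no_triangle no_loops' by (auto simp: A_def B_def mem_nbhd_iff)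
  have fin: "finite A" "finite B"
    by (simp_all add: A_def B_def finite_nbhd)
  have nbhds: "nbhd G x = insert y A" "nbhd G y = insert x B"
    using xy yx by (auto simp: A_def B_def mem_nbhd_iff)
  have "card (nbhd G x) = d" "card (nbhd G y) = d"
    using regular V by auto
  then have card: "Suc (card A) = d" "Suc (card B) = d"
    unfolding nbhds using fin AB by auto
  have t: "t > 0" using \<beta> by (simp add: t_def)
  have d: "d > 0" using degree_pos[OF xy] .
  have c: "0 \<le> c" "c \<le> \<epsilon>"
    using \<epsilon> d by (auto simp: c_def divide_le_eq mult_le_cancel_left1)
  have dc: "real d * c = \<epsilon>" using d by (simp add: c_def)
  have walks: "lazy_walk G \<epsilon> x v = (1 - \<epsilon>) * of_bool (v = x) + c * of_bool (v = y) + c * of_bool (v \<in> A)"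
    "lazy_walk G \<epsilon> y v = (1 - \<epsilon>) * of_bool (v = y) + c * of_bool (v = x) + c * of_bool (v \<in> B)" for v
    using AB \<open>x \<noteq> y\<close> card fin by (auto simp: lazy_walk_def nbhds c_def)
  have rows: "(\<Sum>w\<in>?V. of_bool (v \<in> A \<and> w \<in> B \<and> (v, w) \<in> parcs G)) = t * of_bool (v \<in> A)" for v
  proof -
    have eq: "?V \<inter> {w. w \<in> B \<and> (v, w) \<in> parcs G} = {w \<in> B. (v, w) \<in> parcs G}"
      using V by auto
    have "card {w \<in> B. (v, w) \<in> parcs G} = \<beta> - 1" if "v \<in> A"
      using card_nbhd_cross[OF xy no_triangle] that unfolding A_def B_def by blast
    then show ?thesis
      using V(3) by (cases "v \<in> A") (simp_all add: eq t_def)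
  qed
  have columns: "(\<Sum>v\<in>?V. of_bool (v \<in> A \<and> w \<in> B \<and> (v, w) \<in> parcs G)) = t * of_bool (w \<in> B)" for w
  proof -
    have eq: "?V \<inter> {v. v \<in> A \<and> (v, w) \<in> parcs G} = {v \<in> A. (w, v) \<in> parcs G}"
      using V arc_commute by auto
    have "card {v \<in> A. (w, v) \<in> parcs G} = \<beta> - 1" if "w \<in> B"
      \<comment> \<open>The reversed edge swaps the roles of \<open>A\<close> and
        \<open>B\<close>.\<close>
      using card_nbhd_cross[OF yx] no_triangle that unfolding A_def B_def by blast
    then show ?thesis
      using V(3) by (cases "w \<in> B") (simp_all add: eq t_def)
  qed
  have plan: "transport_plan G (lazy_walk G \<epsilon> x) (lazy_walk G \<epsilon> y) \<xi>"
  proof (rule transport_planI)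
    show "finite ?V" by fact
    \<comment> \<open>The coefficient 1 - \<epsilon> - \<open>c\<close> is nonnegative since
      \<open>c\<close> \<le> \<epsilon> \<le> 1/2.\<close>
    show "0 \<le> \<xi> v w" for v w
      using c \<epsilon> t unfolding \<xi>_def by (intro add_nonneg_nonneg mult_nonneg_nonneg) auto
    show "(\<Sum>w\<in>?V. \<xi> v w) = lazy_walk G \<epsilon> x v" for v
      using V t unfolding \<xi>_def sum.distrib sum_distrib_left[symmetric] rows walks
      by (simp add: algebra_simps)
    show "(\<Sum>v\<in>?V. \<xi> v w) = lazy_walk G \<epsilon> y w" for w
      using V t unfolding \<xi>_def sum.distrib sum_distrib_left[symmetric] columns walks
      by (simp add: algebra_simps)
    show "lazy_walk G \<epsilon> x v \<le> 1" for v
      using AB c \<epsilon> \<open>x \<noteq> y\<close> unfolding walks by auto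
  qed
  have cost: "(\<Sum>v\<in>?V. \<Sum>w\<in>?V. graph_dist G v w * \<xi> v w) = 1 - 2 * \<epsilon> / real d"
  proof -
    \<comment> \<open>The stationary terms have distance 0 and all others lie on edges, so the
      distance factor disappears.\<close>
    have summand: "graph_dist G v w * \<xi> v w =
      (1 - \<epsilon> - c) * (of_bool (v = x) * of_bool (w = y))
        + c / t * of_bool (v \<in> A \<and> w \<in> B \<and> (v, w) \<in> parcs G)" for v w
      using V AB graph_dist_self graph_dist_arc xy \<open>x \<noteq> y\<close> by (auto simp: \<xi>_def)
    have "(\<Sum>v\<in>?V. \<Sum>w\<in>?V. graph_dist G v w * \<xi> v w) = 1 - \<epsilon> - c + c * card A"
      using V t unfolding summand sum.distrib sum_distrib_left[symmetric] rows
      by (simp add: sum_distrib_left[symmetric] Int_absorb1)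
    also have "\<dots> = 1 - \<epsilon> - 2 * c + real d * c"
      using card(1) by (auto simp: algebra_simps)
    finally show ?thesis unfolding dc by (simp add: c_def)
  qed
  have lower: "1 - 2 * \<epsilon> / real d \<le> (\<Sum>v\<in>?V. \<Sum>w\<in>?V. graph_dist G v w * \<zeta> v w)"
    if "transport_plan G (lazy_walk G \<epsilon> x) (lazy_walk G \<epsilon> y) \<zeta>" for \<zeta>
  proof -
    have "sum (lazy_walk G \<epsilon> x) (insert x A) = 1 - \<epsilon> + c * card A"
      unfolding walks using AB fin \<open>x \<noteq> y\<close>
      by (simp add: sum.distrib sum_distrib_left[symmetric])
    \<comment> \<open>The set avoids \<open>y\<close>, and triangle-freeness makes \<open>A\<close>
      disjoint from \<open>B\<close>, so only the mass at \<open>x\<close> counts.\<close>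
    moreover have "sum (lazy_walk G \<epsilon> y) (insert x A) = c"
      unfolding walks using AB fin \<open>x \<noteq> y\<close>
      by (simp add: sum.distrib sum_distrib_left[symmetric] Int_commute)
    moreover have "c * card A = real d * c - c"
      using card(1) by (auto simp: algebra_simps)
    ultimately have "sum (lazy_walk G \<epsilon> x) (insert x A) - sum (lazy_walk G \<epsilon> y) (insert x A)
      = 1 - 2 * \<epsilon> / real d"
      unfolding dc by (simp add: c_def)
    moreover have "sum (lazy_walk G \<epsilon> x) (insert x A) - sum (lazy_walk G \<epsilon> y) (insert x A)
      \<le> (\<Sum>v\<in>?V. \<Sum>w\<in>?V. graph_dist G v w * \<zeta> v w)"
      using V that
      by (intro transport_cost_ge_excess) (auto intro!: graph_dist_nonneg graph_dist_distinct_ge_1)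
    ultimately show ?thesis by simp
  qed
  show ?thesis by (rule transport_dist_eqI[OF plan cost lower])
qed

section \<open>Curvature of an edge\<close>

lemma condensed_ricci_arc:
  assumes xy: "(x, y) \<in> parcs G"
    and "\<And>z. (x, z) \<in> parcs G \<Longrightarrow> (y, z) \<notin> parcs G"
    and "2 \<le> \<beta>"
  shows "condensed_ricci G x y = 2 / real d"
proof -
  \<comment> \<open>The transport distance is affine in \<epsilon> near 0, so the quotient is
    already constant before the limit.\<close>
  have "eps_curvature G \<epsilon> x y / \<epsilon> = 2 / real d" if "0 < \<epsilon>" "\<epsilon> < 1 / 2" for \<epsilon>
    using that transport_dist_lazy_walk[OF assms, of \<epsilon>] graph_dist_arc[OF xy]
    by (simp add: eps_curvature_def)
  then have "eventually (\<lambda>\<epsilon>. eps_curvature G \<epsilon> x y / \<epsilon> = 2 / real d) (at_right 0)"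
    unfolding eventually_at_right_field by (intro exI[of _ "1 / 2"]) simp
  then show ?thesis
    unfolding condensed_ricci_def by (rule Lim_at_right_eventually_const)
qed

end

theorem theorem1p6:
  fixes G :: "'a pair_pre_digraph" and n d \<alpha> \<beta> :: nat
  assumes "strongly_regular_graph G n d \<alpha> \<beta>"
    and "girth G = 4"
  shows "\<forall>(x, y) \<in> parcs G. condensed_ricci G x y = 2 / real d \<and> condensed_ricci G x y > 0"
proof -
  interpret strongly_regular_graph G n d \<alpha> \<beta> by fact
  have "condensed_ricci G x y = 2 / real d \<and> condensed_ricci G x y > 0" if xy: "(x, y) \<in> parcs G" for x y
  proof -
    have "(y, z) \<notin> parcs G" if "(x, z) \<in> parcs G" for z
      using girth_le_3_if_triangle[of x y z] xy that arc_commute assms(2) by auto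
    \<comment> \<open>Positivity rests on \<open>0 < d\<close>, since \<open>2 / 0\<close> would
      evaluate to 0; the edge itself guarantees it.\<close>
    then show ?thesis
      using condensed_ricci_arc[OF xy] beta_ge_2_if_girth_4 degree_pos[OF xy] assms(2) by simp
  qed
  then show ?thesis by auto
qed

end
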